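(* Let $n,d\ge 1$, $k\ge 0$ be integers, $\mathbf{q}=(q_1,\ldots,q_d)$ a vector of integers $q_i\ge 2$, $v$ a vertex of the grid $\mathcal{P}_n^d$, and $D$ a distribution of $k$ pebbles on $\mathcal{P}_n^d$ (an element of $\mathcal{D}_{\mathcal{P}_n^d,k}$). If $D$ is $v$-solvable (under $\mathbf{q}$-pebbling) then $$\sum_{w\in\mathcal{P}_n^d}\frac{D(w)}{\mathbf{q}^{\mathbf{d}(w,v)}}\ge 1.$$ Also, if $$\sum_{w\in\mathcal{P}_n^d}\frac{D(w)}{\mathbf{q}^{\mathbf{d}(w,v)}}>\sum_{w\neq v}\frac{\max_i(q_i)-1}{\mathbf{q}^{\mathbf{d}(w,v)}},$$ then $D$ is $v$-solvable.
   Context: $\mathcal{P}_n^d$ is the $d$-dimensional grid graph with vertex set $[n]^d=\{1,\ldots,n\}^d$, two vertices being adjacent iff they differ by exactly $1$ in one coordinate and agree in all others. A distribution of $k$ pebbles is a function $D:[n]^d\to\mathbb{Z}_{\ge 0}$ with $\sum_w D(w)=k$; $D(w)$ is the number of pebbles on $w$. A $\mathbf{q}$-pebbling move in coordinate $i$ removes $q_i$ pebbles from a vertex $w$ and adds one pebble to a vertex adjacent to $w$ that differs from $w$ in coordinate $i$. $D$ is $v$-solvable if some finite (possibly empty) sequence of moves leads to a configuration with at least one pebble on $v$. For vertices $a,b$, the pebbling distance is $\mathbf{q}^{\mathbf{d}(a,b)}=\prod_{i=1}^d q_i^{|a_i-b_i|}$. *)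

theory Defs
  imports Complex_Main "HOL-Library.FuncSet"
begin

text \<open>Vertices are extensional functions on the coordinate set, so that distinct vertices
  are distinct points of \<open>[n]\<^sup>d\<close>; likewise distributions are extensional on the vertex set.\<close>

type_synonym vertex = "nat \<Rightarrow> nat"

definition grid :: "nat \<Rightarrow> nat \<Rightarrow> vertex set" where
  "grid n d = {1..d} \<rightarrow>\<^sub>E {1..n}"

definition grid_adj :: "nat \<Rightarrow> nat \<Rightarrow> vertex \<Rightarrow> vertex \<Rightarrow> bool" where
  "grid_adj n d a b \<longleftrightarrow> a \<in> grid n d \<and> b \<in> grid n d \<and>
     (\<exists>i\<in>{1..d}. \<bar>int (a i) - int (b i)\<bar> = 1 \<and> (\<forall>j\<in>{1..d} - {i}. a j = b j))"

definition distributions :: "nat \<Rightarrow> nat \<Rightarrow> nat \<Rightarrow> (vertex \<Rightarrow> nat) set" where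
  "distributions n d k = {D \<in> grid n d \<rightarrow>\<^sub>E UNIV. (\<Sum>w\<in>grid n d. D w) = k}"

text \<open>In the following definition \<open>a \<noteq> b\<close>, so the two updates do not interfere.\<close>

definition pebbling_move_in ::
    "nat \<Rightarrow> nat \<Rightarrow> (nat \<Rightarrow> nat) \<Rightarrow> nat \<Rightarrow> (vertex \<Rightarrow> nat) \<Rightarrow> (vertex \<Rightarrow> nat) \<Rightarrow> bool" where
  "pebbling_move_in n d q i D D' \<longleftrightarrow>
     (\<exists>a b. grid_adj n d a b \<and> a i \<noteq> b i \<and> D a \<ge> q i \<and>
            D' = D(a := D a - q i, b := D b + 1))"

definition pebbling_move ::
    "nat \<Rightarrow> nat \<Rightarrow> (nat \<Rightarrow> nat) \<Rightarrow> (vertex \<Rightarrow> nat) \<Rightarrow> (vertex \<Rightarrow> nat) \<Rightarrow> bool" where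
  "pebbling_move n d q D D' \<longleftrightarrow> (\<exists>i\<in>{1..d}. pebbling_move_in n d q i D D')"

definition solvable ::
    "nat \<Rightarrow> nat \<Rightarrow> (nat \<Rightarrow> nat) \<Rightarrow> vertex \<Rightarrow> (vertex \<Rightarrow> nat) \<Rightarrow> bool" where
  "solvable n d q v D \<longleftrightarrow> (\<exists>D'. (pebbling_move n d q)\<^sup>*\<^sup>* D D' \<and> D' v \<ge> 1)"

definition pebbling_dist :: "nat \<Rightarrow> (nat \<Rightarrow> nat) \<Rightarrow> vertex \<Rightarrow> vertex \<Rightarrow> nat" where
  "pebbling_dist d q a b = (\<Prod>i\<in>{1..d}. q i ^ nat \<bar>int (a i) - int (b i)\<bar>)"

end

theory Submission
  imports Defs
begin

text \<open>A move in coordinate \<open>i\<close> trades \<open>q\<^sub>i\<close> pebbles for one whose weight \<open>1 / q\<^sup>d\<^sup>(\<^sup>w\<^sup>,\<^sup>v\<^sup>)\<close> is at most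
  \<open>q\<^sub>i\<close> times larger, so the total weight never increases, and a pebble on \<open>v\<close> alone weighs \<open>1\<close>.
  Conversely, moves towards \<open>v\<close> preserve the total weight exactly.  As long as \<open>v\<close> is empty
  and the weight exceeds the given bound, some vertex \<open>w \<noteq> v\<close> holds at least \<open>max q\<^sub>i\<close> pebbles, so
  such a move is possible; the number of pebbles drops, so the process ends with a pebble on \<open>v\<close>.\<close>

lemma finite_grid: "finite (grid n d)"
  unfolding grid_def by (simp add: finite_PiE)

lemma pebbling_dist_self [simp]: "pebbling_dist d q v v = 1"
  by (simp add: pebbling_dist_def)

lemma pebbling_dist_pos:
  assumes "\<forall>i\<in>{1..d}. q i \<ge> 2"
  shows "pebbling_dist d q a b > 0"
  unfolding pebbling_dist_def using assms by (intro prod_pos) fastforce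

lemma pebbling_dist_split:
  assumes "i \<in> {1..d}"
  shows "pebbling_dist d q a b = q i ^ nat \<bar>int (a i) - int (b i)\<bar> *
           (\<Prod>j\<in>{1..d} - {i}. q j ^ nat \<bar>int (a j) - int (b j)\<bar>)"
  unfolding pebbling_dist_def using assms by (intro prod.remove) auto

text \<open>Only the factor of coordinate \<open>i\<close> differs between the two products, and its
  exponent is one larger for \<open>a\<close>.\<close>

lemma pebbling_dist_eq_mult:
  assumes "i \<in> {1..d}" and "\<forall>j\<in>{1..d} - {i}. a j = b j"
    and "\<bar>int (a i) - int (v i)\<bar> = \<bar>int (b i) - int (v i)\<bar> + 1"
  shows "pebbling_dist d q a v = q i * pebbling_dist d q b v"
proof -
  have "nat \<bar>int (a i) - int (v i)\<bar> = Suc (nat \<bar>int (b i) - int (v i)\<bar>)"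
    using assms(3) by linarith
  moreover have "(\<Prod>j\<in>{1..d} - {i}. q j ^ nat \<bar>int (a j) - int (v j)\<bar>) =
      (\<Prod>j\<in>{1..d} - {i}. q j ^ nat \<bar>int (b j) - int (v j)\<bar>)"
    using assms(2) by (intro prod.cong) auto
  ultimately show ?thesis
    by (simp add: pebbling_dist_split[OF assms(1)])
qed

lemma pebbling_dist_le_mult:
  assumes q: "\<forall>i\<in>{1..d}. q i \<ge> 2" and i: "i \<in> {1..d}"
    and off: "\<forall>j\<in>{1..d} - {i}. a j = b j"
    and step: "\<bar>int (a i) - int (b i)\<bar> = 1"
  shows "pebbling_dist d q a v \<le> q i * pebbling_dist d q b v"
proof (cases "\<bar>int (a i) - int (v i)\<bar> = \<bar>int (b i) - int (v i)\<bar> + 1")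
  case True
  then show ?thesis using pebbling_dist_eq_mult[OF i off] by simp
next
  case False
  \<comment> \<open>A unit step on the integers changes the distance to \<open>v i\<close> by
    exactly one, so a step that does not approach \<open>v\<close> recedes from it. The roles of
    \<open>a\<close> and \<open>b\<close> then swap, leaving a slack factor of
    \<open>q i * q i\<close>.\<close>
  then have "\<bar>int (b i) - int (v i)\<bar> = \<bar>int (a i) - int (v i)\<bar> + 1"
    using step by linarith
  then have "pebbling_dist d q b v = q i * pebbling_dist d q a v"
    using off by (intro pebbling_dist_eq_mult[OF i]) auto
  moreover have "1 \<le> q i" using q i by fastforce
  then have "1 * 1 \<le> q i * q i" by (rule mult_le_mono) fact
  then have "1 * pebbling_dist d q a v \<le> (q i * q i) * pebbling_dist d q a v"
    by (intro mult_le_mono1) simp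
  ultimately show ?thesis by (simp add: mult.assoc)
qed

text \<open>Stated for arbitrary \<open>f\<close> to serve twice: reciprocal distances give the
  change in weight, the constant \<open>1\<close> the change in the number of pebbles.\<close>

lemma sum_weighted_move:
  fixes f :: "'a \<Rightarrow> real" and D :: "'a \<Rightarrow> nat"
  assumes fin: "finite A" and ab: "a \<in> A" "b \<in> A" "a \<noteq> b" and m: "m \<le> D a"
  shows "(\<Sum>w\<in>A. real ((D(a := D a - m, b := D b + 1)) w) * f w) =
         (\<Sum>w\<in>A. real (D w) * f w) - real m * f a + f b"
proof -
  have "(\<Sum>w\<in>A. real ((D(a := D a - m, b := D b + 1)) w) * f w) =
      (\<Sum>w\<in>A. real (D w) * f w - (if w = a then real m * f w else 0) + (if w = b then f w else 0))"
    using ab m by (intro sum.cong) (auto simp: of_nat_diff algebra_simps)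
  also have "\<dots> = (\<Sum>w\<in>A. real (D w) * f w) - real m * f a + f b"
    using fin ab by (simp add: sum.distrib sum_subtractf sum.delta)
  finally show ?thesis .
qed

definition weight :: "nat \<Rightarrow> nat \<Rightarrow> (nat \<Rightarrow> nat) \<Rightarrow> vertex \<Rightarrow> (vertex \<Rightarrow> nat) \<Rightarrow> real" where
  "weight n d q v D = (\<Sum>w\<in>grid n d. real (D w) / real (pebbling_dist d q w v))"

lemma weight_move:
  assumes "a \<in> grid n d" "b \<in> grid n d" "a \<noteq> b" "m \<le> D a"
  shows "weight n d q v (D(a := D a - m, b := D b + 1)) =
    weight n d q v D - real m / real (pebbling_dist d q a v) + 1 / real (pebbling_dist d q b v)"
  using sum_weighted_move[where D = D and f = "\<lambda>w. 1 / real (pebbling_dist d q w v)",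
      OF finite_grid assms]
  by (simp add: weight_def)

lemma weight_pebbling_move_le:
  assumes q: "\<forall>i\<in>{1..d}. q i \<ge> 2" and move: "pebbling_move n d q D D'"
  shows "weight n d q v D' \<le> weight n d q v D"
proof -
  obtain i a b where i: "i \<in> {1..d}" and adj: "grid_adj n d a b" and ne: "a i \<noteq> b i"
    and le: "q i \<le> D a" and D': "D' = D(a := D a - q i, b := D b + 1)"
    using move unfolding pebbling_move_def pebbling_move_in_def by blast
  have off: "\<forall>j\<in>{1..d} - {i}. a j = b j" and step: "\<bar>int (a i) - int (b i)\<bar> = 1"
    using adj i ne unfolding grid_adj_def by blast+
  have "real (pebbling_dist d q a v) \<le> real (q i) * real (pebbling_dist d q b v)"
    using pebbling_dist_le_mult[OF q i off step, of v]
    by (metis of_nat_le_iff of_nat_mult)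
  then have "1 / real (pebbling_dist d q b v) \<le> real (q i) / real (pebbling_dist d q a v)"
    using pebbling_dist_pos[OF q] by (simp add: field_simps)
  moreover have "a \<in> grid n d" "b \<in> grid n d" "a \<noteq> b"
    using adj ne unfolding grid_adj_def by auto
  ultimately show ?thesis
    using weight_move[of a n d b "q i" D q v] le D' by simp
qed

lemma weight_ge_1_if_solvable:
  assumes q: "\<forall>i\<in>{1..d}. q i \<ge> 2" and v: "v \<in> grid n d" and solv: "solvable n d q v D"
  shows "weight n d q v D \<ge> 1"
proof -
  obtain D' where moves: "(pebbling_move n d q)\<^sup>*\<^sup>* D D'" and D': "D' v \<ge> 1"
    using solv unfolding solvable_def by blast
  have "1 \<le> real (D' v) / real (pebbling_dist d q v v)" using D' by simp
  also have "\<dots> \<le> weight n d q v D'"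
    unfolding weight_def using v by (intro member_le_sum) (auto simp: finite_grid)
  also have "\<dots> \<le> weight n d q v D"
    using moves by induction (auto dest: weight_pebbling_move_le[OF q, of n _ _ v])
  finally show ?thesis .
qed

lemma grid_step_towards:
  assumes w: "w \<in> grid n d" and v: "v \<in> grid n d" and ne: "w \<noteq> v"
  obtains i b where "i \<in> {1..d}" "grid_adj n d w b" "w i \<noteq> b i"
    "\<forall>j\<in>{1..d} - {i}. w j = b j"
    "\<bar>int (w i) - int (v i)\<bar> = \<bar>int (b i) - int (v i)\<bar> + 1"
proof -
  \<comment> \<open>Vertices are extensional, so distinct ones must differ inside
    \<open>{1..d}\<close>.\<close>
  obtain i where i: "i \<in> {1..d}" and wv: "w i \<noteq> v i"
    using assms PiE_ext unfolding grid_def by metis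
  \<comment> \<open>The new coordinate lies between \<open>w i\<close> and \<open>v i\<close>, hence
    in \<open>{1..n}\<close>. In the second branch \<open>w i > v i \<ge> 1\<close>, so the
    subtraction does not truncate.\<close>
  define b where "b = w(i := if w i < v i then w i + 1 else w i - 1)"
  have range: "w i \<in> {1..n}" "v i \<in> {1..n}"
    using w v i unfolding grid_def by auto
  have "b i \<in> {1..n}" using range wv by (auto simp: b_def)
  then have "b \<in> grid n d"
    using w i by (auto simp: b_def grid_def PiE_iff extensional_def)
  moreover have "\<bar>int (w i) - int (b i)\<bar> = 1"
    "\<bar>int (w i) - int (v i)\<bar> = \<bar>int (b i) - int (v i)\<bar> + 1"
    using range wv by (auto simp: b_def)
  moreover have "\<forall>j\<in>{1..d} - {i}. w j = b j" by (simp add: b_def)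
  ultimately show ?thesis
    using that[of i b] i w unfolding grid_adj_def by fastforce
qed

lemma solvable_if_weight_gt:
  assumes q: "\<forall>i\<in>{1..d}. q i \<ge> 2" and v: "v \<in> grid n d"
    and "weight n d q v D >
      (\<Sum>w\<in>grid n d - {v}. (real (Max (q ` {1..d})) - 1) / real (pebbling_dist d q w v))"
  shows "solvable n d q v D"
  using assms(3)
proof (induction "\<Sum>w\<in>grid n d. D w" arbitrary: D rule: less_induct)
  case less
  let ?M = "Max (q ` {1..d})"
  show ?case
  proof (cases "D v = 0")
    case False
    then show ?thesis unfolding solvable_def by (intro exI[of _ D]) auto
  next
    case True
    \<comment> \<open>Pigeonhole: at most \<open>?M - 1\<close> pebbles on each vertex other than
      the empty \<open>v\<close> would keep the weight within the bound. The maximum is used because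
      the coordinate of the move is known only once \<open>w\<close> is chosen.\<close>
    have "\<exists>w\<in>grid n d - {v}. D w \<ge> ?M"
    proof (rule ccontr)
      assume none: "\<not> ?thesis"
      then have small: "real (D w) \<le> real ?M - 1" if "w \<in> grid n d - {v}" for w
      proof -
        have "D w < ?M" using none that by (meson not_le)
        then show ?thesis by linarith
      qed
      have "weight n d q v D =
          (\<Sum>w\<in>grid n d - {v}. real (D w) / real (pebbling_dist d q w v))"
        unfolding weight_def using True v by (simp add: sum.remove[OF finite_grid v])
      also have "\<dots> \<le> (\<Sum>w\<in>grid n d - {v}. (real ?M - 1) / real (pebbling_dist d q w v))"
        by (intro sum_mono divide_right_mono small) auto
      finally show False using less.prems by simp
    qed
    then obtain w where w: "w \<in> grid n d" "w \<noteq> v" and Dw: "D w \<ge> ?M" by auto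
    obtain i b where i: "i \<in> {1..d}" and adj: "grid_adj n d w b" and ne: "w i \<noteq> b i"
      and off: "\<forall>j\<in>{1..d} - {i}. w j = b j"
      and closer: "\<bar>int (w i) - int (v i)\<bar> = \<bar>int (b i) - int (v i)\<bar> + 1"
      using grid_step_towards[OF w(1) v w(2)] by blast
    have "q i \<le> ?M" using i by (intro Max_ge) auto
    then have le: "q i \<le> D w" using Dw by simp
    have wb: "w \<in> grid n d" "b \<in> grid n d" "w \<noteq> b"
      using adj ne unfolding grid_adj_def by auto
    have qi: "q i \<ge> 2" using q i by blast
    define D' where "D' = D(w := D w - q i, b := D b + 1)"
    have move: "pebbling_move n d q D D'"
      unfolding pebbling_move_def pebbling_move_in_def D'_def using i adj ne le by blast
    \<comment> \<open>The \<open>q i\<close> pebbles removed from \<open>w\<close> weigh exactly as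
      much as the one added to \<open>b\<close>, which is closer to \<open>v\<close> by one step in
      coordinate \<open>i\<close>. So the strict bound passes to \<open>D'\<close>.\<close>
    have "weight n d q v D' = weight n d q v D"
      using weight_move[where D = D, OF wb le, of q v] pebbling_dist_eq_mult[where v = v and q = q, OF i off closer]
        pebbling_dist_pos[OF q] qi
      by (simp add: D'_def)
    moreover have "(\<Sum>w\<in>grid n d. D' w) < (\<Sum>w\<in>grid n d. D w)"
    proof -
      \<comment> \<open>The net loss is \<open>q i - 1\<close>, which is positive because
        \<open>q i \<ge> 2\<close>; this is the decrease that the induction requires.\<close>
      have "real (\<Sum>w\<in>grid n d. D' w) = real (\<Sum>w\<in>grid n d. D w) - real (q i) + 1"
        using sum_weighted_move[where D = D and f = "\<lambda>_. 1", OF finite_grid wb le]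
        by (simp add: D'_def)
      then show ?thesis using qi by linarith
    qed
    ultimately have "solvable n d q v D'"
      using less.hyps less.prems by simp
    then show ?thesis
      using move unfolding solvable_def by (meson converse_rtranclp_into_rtranclp)
  qed
qed

theorem lemma4:
  fixes n d k :: nat and q :: "nat \<Rightarrow> nat" and v :: vertex and D :: "vertex \<Rightarrow> nat"
  assumes "n \<ge> 1" and "d \<ge> 1"
    and "\<forall>i\<in>{1..d}. q i \<ge> 2"
    and "v \<in> grid n d"
    and "D \<in> distributions n d k"
  shows "(solvable n d q v D \<longrightarrow>
            (\<Sum>w\<in>grid n d. real (D w) / real (pebbling_dist d q w v)) \<ge> 1)
       \<and> ((\<Sum>w\<in>grid n d. real (D w) / real (pebbling_dist d q w v)) >
            (\<Sum>w\<in>grid n d - {v}.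
               (real (Max (q ` {1..d})) - 1) / real (pebbling_dist d q w v))
          \<longrightarrow> solvable n d q v D)"
  using weight_ge_1_if_solvable[OF assms(3,4), of D] solvable_if_weight_gt[OF assms(3,4), of D]
  unfolding weight_def by blast

end
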